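(* Let $X$ be a complete MAP topological group. If $X$ has the $SB$-property, then (i) $X$ respects each of the following properties: sequentiality, compactness, sequential compactness, countable compactness, pseudocompactness, and functional boundedness; (ii) $X^+$ is a $\mu$-space.
   Context: Groups are Hausdorff and not necessarily Abelian; "complete" means Raĭkov complete. For a topological group $X$ let $bX$ be its Bohr compactification, with canonical continuous homomorphism $i:X\to bX$ onto a dense subgroup. $X^+$ is the group $X$ with the topology induced from $bX$ via $i$. $X$ is MAP (maximally almost periodic) if $X^+$ is Hausdorff. A subset $E$ of a space $Y$ is functionally bounded in $Y$ if every continuous real-valued function on $Y$ is bounded on $E$. For a space $Y$ let $\mathcal{S}(Y)$ be the set of all convergent sequences in $Y$ taken together with their limit points, $\mathcal{C}(Y)$, $\mathcal{SC}(Y)$, $\mathcal{CC}(Y)$, $\mathcal{PC}(Y)$ the sets of all compact, sequentially compact, countably compact, pseudocompact subsets of $Y$, and $\mathcal{FB}(Y)$ the set of all functionally bounded subsets in $Y$. A MAP group $X$ respects sequentiality, compactness, sequential compactness, countable compactness, pseudocompactness, functional boundedness if $\mathcal{P}(X)=\mathcal{P}(X^+)$ for $\mathcal{P}=\mathcal{S},\mathcal{C},\mathcal{SC},\mathcal{CC},\mathcal{PC},\mathcal{FB}$ respectively. (A subset $A$ is countably compact if each countably infinite subset of $A$ has a cluster point in $A$; sequentially compact if each sequence in $A$ has a subsequence converging to a point of $A$.) A MAP group $X$ has the $SB$-property if every functionally bounded sequence in $X^+$ is also functionally bounded in $X$. A space $Y$ is a $\mu$-space if every functionally bounded subset of $Y$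 has compact closure in $Y$. *)

theory Defs
  imports "HOL-Analysis.Analysis" "HOL-Algebra.Product_Groups"
begin

section \<open>Topological groups and Raikov completeness\<close>

locale topological_group = group G for G (structure) +
  fixes T :: "'a topology"
  assumes topspace_eq_carrier: "topspace T = carrier G"
    and Hausdorff: "Hausdorff_space T"
    and continuous_mult: "continuous_map (prod_topology T T) T (\<lambda>(x, y). x \<otimes> y)"
    and continuous_inv: "continuous_map T T (\<lambda>x. inv x)"

text \<open>Cauchy filters for the two-sided uniformity, i.e. the join of the left and the right
  uniformity of the group; the group is Raikov complete if all of them converge.\<close>

definition raikov_cauchy_filter ::
    "('a, 'm) monoid_scheme \<Rightarrow> 'a topology \<Rightarrow> 'a filter \<Rightarrow> bool" where
  "raikov_cauchy_filter G T F \<longleftrightarrow>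
     F \<noteq> bot \<and> F \<le> principal (carrier G) \<and>
     (\<forall>U. openin T U \<and> \<one>\<^bsub>G\<^esub> \<in> U \<longrightarrow>
        (\<exists>A \<subseteq> carrier G. eventually (\<lambda>x. x \<in> A) F \<and>
           (\<forall>x\<in>A. \<forall>y\<in>A. inv\<^bsub>G\<^esub> x \<otimes>\<^bsub>G\<^esub> y \<in> U \<and> x \<otimes>\<^bsub>G\<^esub> inv\<^bsub>G\<^esub> y \<in> U)))"

definition raikov_complete :: "('a, 'm) monoid_scheme \<Rightarrow> 'a topology \<Rightarrow> bool" where
  "raikov_complete G T \<longleftrightarrow>
     (\<forall>F. raikov_cauchy_filter G T F \<longrightarrow> (\<exists>l. limitin T (\<lambda>x. x) l F))"


section \<open>The Bohr compactification\<close>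

text \<open>The Bohr compactification of \<open>X\<close> is the closure of the image of \<open>X\<close> in the product of all
  compact groups \<open>K\<close> that receive a continuous homomorphism \<open>f\<close> from \<open>X\<close>.  To index the product
  by a set, the groups \<open>K\<close> range over those with elements of type \<^typ>\<open>'a set set\<close>, where
  \<open>'a\<close> is the type of the elements of \<open>X\<close>.  This is no restriction: in a compact (Hausdorff) group
  a point \<open>k\<close> of the closure of the image of \<open>f\<close> is determined by the set of all preimages
  under \<open>f\<close> of open neighbourhoods of \<open>k\<close>. The universal property with respect
  to compact groups over an arbitrary type is proved in \<open>bohr_universal\<close> below.\<close>

definition bohr_index :: "('a, 'm) monoid_scheme \<Rightarrow> 'a topology \<Rightarrow>
    ('a set set monoid \<times> 'a set set topology \<times> ('a \<Rightarrow> 'a set set)) set" where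
  "bohr_index X T =
     {(K, S, f). topological_group K S \<and> compact_space S \<and> f \<in> hom X K \<and> continuous_map T S f}"

definition bohr_map :: "('a, 'm) monoid_scheme \<Rightarrow> 'a topology \<Rightarrow> 'a \<Rightarrow>
    ('a set set monoid \<times> 'a set set topology \<times> ('a \<Rightarrow> 'a set set)) \<Rightarrow> 'a set set" where
  "bohr_map X T x = (\<lambda>(K, S, f) \<in> bohr_index X T. f x)"

definition bohr_product_topology :: "('a, 'm) monoid_scheme \<Rightarrow> 'a topology \<Rightarrow>
    (('a set set monoid \<times> 'a set set topology \<times> ('a \<Rightarrow> 'a set set)) \<Rightarrow> 'a set set) topology" where
  "bohr_product_topology X T = product_topology (\<lambda>(K, S, f). S) (bohr_index X T)"

definition bohr_carrier :: "('a, 'm) monoid_scheme \<Rightarrow> 'a topology \<Rightarrow>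
    (('a set set monoid \<times> 'a set set topology \<times> ('a \<Rightarrow> 'a set set)) \<Rightarrow> 'a set set) set" where
  "bohr_carrier X T = bohr_product_topology X T closure_of (bohr_map X T ` carrier X)"

definition bohr_group :: "('a, 'm) monoid_scheme \<Rightarrow> 'a topology \<Rightarrow>
    (('a set set monoid \<times> 'a set set topology \<times> ('a \<Rightarrow> 'a set set)) \<Rightarrow> 'a set set) monoid" where
  "bohr_group X T =
     (product_group (bohr_index X T) (\<lambda>(K, S, f). K)) \<lparr>carrier := bohr_carrier X T\<rparr>"

definition bohr_topology :: "('a, 'm) monoid_scheme \<Rightarrow> 'a topology \<Rightarrow>
    (('a set set monoid \<times> 'a set set topology \<times> ('a \<Rightarrow> 'a set set)) \<Rightarrow> 'a set set) topology" where
  "bohr_topology X T = subtopology (bohr_product_topology X T) (bohr_carrier X T)"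

text \<open>The topology of \<open>X\<^sup>+\<close>.\<close>

definition bohr_modification :: "('a, 'm) monoid_scheme \<Rightarrow> 'a topology \<Rightarrow> 'a topology" where
  "bohr_modification X T = pullback_topology (carrier X) (bohr_map X T) (bohr_topology X T)"

definition MAP_group :: "('a, 'm) monoid_scheme \<Rightarrow> 'a topology \<Rightarrow> bool" where
  "MAP_group X T \<longleftrightarrow> topological_group X T \<and> Hausdorff_space (bohr_modification X T)"


section \<open>Compact-like subsets\<close>

definition functionally_bounded :: "'a topology \<Rightarrow> 'a set \<Rightarrow> bool" where
  "functionally_bounded Y E \<longleftrightarrow>
     E \<subseteq> topspace Y \<and> (\<forall>f. continuous_map Y euclideanreal f \<longrightarrow> bounded (f ` E))"

definition convergent_sequence_sets :: "'a topology \<Rightarrow> 'a set set" where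
  "convergent_sequence_sets Y =
     {range s \<union> {l} | (s :: nat \<Rightarrow> 'a) l. range s \<subseteq> topspace Y \<and> limitin Y s l sequentially}"

definition compact_sets :: "'a topology \<Rightarrow> 'a set set" where
  "compact_sets Y = {A. compactin Y A}"

definition sequentially_compact_sets :: "'a topology \<Rightarrow> 'a set set" where
  "sequentially_compact_sets Y =
     {A. A \<subseteq> topspace Y \<and>
         (\<forall>s :: nat \<Rightarrow> 'a. range s \<subseteq> A \<longrightarrow>
            (\<exists>l\<in>A. \<exists>r :: nat \<Rightarrow> nat. strict_mono r \<and> limitin Y (s \<circ> r) l sequentially))}"

definition countably_compact_sets :: "'a topology \<Rightarrow> 'a set set" where
  "countably_compact_sets Y =
     {A. A \<subseteq> topspace Y \<and>
         (\<forall>B \<subseteq> A. countable B \<and> infinite B \<longrightarrow> A \<inter> Y derived_set_of B \<noteq> {})}"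

definition pseudocompact_sets :: "'a topology \<Rightarrow> 'a set set" where
  "pseudocompact_sets Y =
     {A. A \<subseteq> topspace Y \<and>
         (\<forall>f. continuous_map (subtopology Y A) euclideanreal f \<longrightarrow> bounded (f ` A))}"

definition functionally_bounded_sets :: "'a topology \<Rightarrow> 'a set set" where
  "functionally_bounded_sets Y = {E. functionally_bounded Y E}"

definition mu_space :: "'a topology \<Rightarrow> bool" where
  "mu_space Y \<longleftrightarrow> (\<forall>E. functionally_bounded Y E \<longrightarrow> compactin Y (Y closure_of E))"

definition respects_property :: "('a, 'm) monoid_scheme \<Rightarrow> 'a topology \<Rightarrow>
    ('a topology \<Rightarrow> 'a set set) \<Rightarrow> bool" where
  "respects_property X T P \<longleftrightarrow> P T = P (bohr_modification X T)"

definition SB_property :: "('a, 'm) monoid_scheme \<Rightarrow> 'a topology \<Rightarrow> bool" where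
  "SB_property X T \<longleftrightarrow>
     (\<forall>s :: nat \<Rightarrow> 'a. functionally_bounded (bohr_modification X T) (range s) \<longrightarrow>
        functionally_bounded T (range s))"


section \<open>The universal property of the Bohr compactification\<close>

lemma closure_of_subgroup:
  assumes G: "topological_group G T" and H: "subgroup H G"
  shows "subgroup (T closure_of H) G"
proof -
  interpret topological_group G T by fact
  have HT: "H \<subseteq> topspace T" using H by (simp add: subgroup.subset topspace_eq_carrier)
  have sub: "H \<subseteq> T closure_of H" by (simp add: HT closure_of_subset)
  have inv: "inv\<^bsub>G\<^esub> x \<in> T closure_of H" if "x \<in> T closure_of H" for x
  proof -
    have "m_inv G ` (T closure_of H) \<subseteq> T closure_of (m_inv G ` H)"
      by (rule continuous_map_image_closure_subset[OF continuous_inv])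
    also have "\<dots> \<subseteq> T closure_of H"
      by (rule closure_of_mono) (use H in \<open>auto intro: subgroup.m_inv_closed\<close>)
    finally show ?thesis using that by blast
  qed
  have mult: "x \<otimes>\<^bsub>G\<^esub> y \<in> T closure_of H" if "x \<in> T closure_of H" "y \<in> T closure_of H" for x y
  proof -
    have "(\<lambda>(x, y). x \<otimes>\<^bsub>G\<^esub> y) ` (prod_topology T T closure_of (H \<times> H))
            \<subseteq> T closure_of ((\<lambda>(x, y). x \<otimes>\<^bsub>G\<^esub> y) ` (H \<times> H))"
      by (rule continuous_map_image_closure_subset[OF continuous_mult])
    also have "\<dots> \<subseteq> T closure_of H"
      by (rule closure_of_mono) (use H in \<open>auto intro: subgroup.m_closed\<close>)
    finally show ?thesis using that by (auto simp: closure_of_Times)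
  qed
  show ?thesis
  proof (rule subgroup.intro)
    show "T closure_of H \<subseteq> carrier G"
      using closure_of_subset_topspace topspace_eq_carrier by metis
    show "\<one>\<^bsub>G\<^esub> \<in> T closure_of H" using sub H subgroup.one_closed by blast
  qed (use inv mult in auto)
qed

lemma topological_group_subgroup:
  assumes G: "topological_group G T" and H: "subgroup H G"
  shows "topological_group (G\<lparr>carrier := H\<rparr>) (subtopology T H)"
proof -
  interpret topological_group G T by fact
  have HT: "H \<subseteq> topspace T" using H by (simp add: subgroup.subset topspace_eq_carrier)
  have grp: "group (G\<lparr>carrier := H\<rparr>)" using H subgroup.subgroup_is_group by (metis group_axioms)
  have minv: "inv\<^bsub>G\<lparr>carrier := H\<rparr>\<^esub> x = inv\<^bsub>G\<^esub> x" if "x \<in> H" for x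
    using H that by (simp add: m_inv_consistent)
  show ?thesis
  proof (intro topological_group.intro topological_group_axioms.intro)
    show "group (G\<lparr>carrier := H\<rparr>)" by (fact grp)
    show "topspace (subtopology T H) = carrier (G\<lparr>carrier := H\<rparr>)"
      using HT by (simp add: Int_absorb1)
    show "Hausdorff_space (subtopology T H)" by (simp add: Hausdorff Hausdorff_space_subtopology)
    have "continuous_map (subtopology (prod_topology T T) (H \<times> H)) (subtopology T H)
            (\<lambda>(x, y). x \<otimes>\<^bsub>G\<^esub> y)"
      by (rule continuous_map_into_subtopology[OF continuous_map_from_subtopology[OF continuous_mult]])
         (use H in \<open>auto intro: subgroup.m_closed\<close>)
    then show "continuous_map (prod_topology (subtopology T H) (subtopology T H)) (subtopology T H)
            (\<lambda>(x, y). x \<otimes>\<^bsub>G\<lparr>carrier := H\<rparr>\<^esub> y)"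
      by (simp add: subtopology_Times)
    have "continuous_map (subtopology T H) (subtopology T H) (m_inv G)"
      by (rule continuous_map_into_subtopology[OF continuous_map_from_subtopology[OF continuous_inv]])
         (use H in \<open>auto intro: subgroup.m_inv_closed\<close>)
    then show "continuous_map (subtopology T H) (subtopology T H) (\<lambda>x. inv\<^bsub>G\<lparr>carrier := H\<rparr>\<^esub> x)"
      by (rule continuous_map_eq) (auto simp: minv)
  qed
qed

lemma topological_group_product:
  assumes GT: "\<And>i. i \<in> I \<Longrightarrow> topological_group (G i) (T i)"
  shows "topological_group (product_group I G) (product_topology T I)"
proof -
  have grp: "group (G i)" if "i \<in> I" for i using GT[OF that] by (simp add: topological_group_def)
  have top: "topspace (T i) = carrier (G i)" if "i \<in> I" for i
    using GT[OF that] by (simp add: topological_group.topspace_eq_carrier)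
  show ?thesis
  proof (intro topological_group.intro topological_group_axioms.intro)
    show "group (product_group I G)" using grp by simp
    show eq: "topspace (product_topology T I) = carrier (product_group I G)"
      using top by (simp cong: PiE_cong)
    show "Hausdorff_space (product_topology T I)"
      using topological_group.Hausdorff[OF GT] by (simp add: Hausdorff_space_product_topology)
    have "continuous_map (prod_topology (product_topology T I) (product_topology T I)) (T i)
            (\<lambda>p. fst p i \<otimes>\<^bsub>G i\<^esub> snd p i)" if i: "i \<in> I" for i
    proof -
      let ?P = "prod_topology (product_topology T I) (product_topology T I)"
      have "continuous_map ?P (T i) (\<lambda>p. fst p i)" "continuous_map ?P (T i) (\<lambda>p. snd p i)"
        using continuous_map_compose[OF continuous_map_fst continuous_map_product_projection[OF i]]
          continuous_map_compose[OF continuous_map_snd continuous_map_product_projection[OF i]]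
        by (simp_all add: o_def)
      then have "continuous_map ?P (prod_topology (T i) (T i)) (\<lambda>p. (fst p i, snd p i))"
        by (simp add: continuous_map_pairwise o_def)
      from continuous_map_compose[OF this topological_group.continuous_mult[OF GT[OF i]]]
      show ?thesis by (simp add: o_def)
    qed
    then show "continuous_map (prod_topology (product_topology T I) (product_topology T I))
        (product_topology T I) (\<lambda>(x, y). x \<otimes>\<^bsub>product_group I G\<^esub> y)"
      by (auto simp: continuous_map_componentwise case_prod_unfold)
    have "continuous_map (product_topology T I) (T i) (\<lambda>x. inv\<^bsub>G i\<^esub> x i)" if i: "i \<in> I" for i
      using continuous_map_compose[OF continuous_map_product_projection[OF i, of T]
          topological_group.continuous_inv[OF GT[OF i]]]
      by (simp add: o_def)
    then have "continuous_map (product_topology T I) (product_topology T I) (\<lambda>x. \<lambda>i\<in>I. inv\<^bsub>G i\<^esub> x i)"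
      by (auto simp: continuous_map_componentwise)
    then show "continuous_map (product_topology T I) (product_topology T I)
        (\<lambda>x. inv\<^bsub>product_group I G\<^esub> x)"
      by (rule continuous_map_eq) (use eq grp in \<open>simp add: inv_product_group\<close>)
  qed
qed

lemma topological_group_transport:
  fixes K :: "('c, 'k) monoid_scheme" and h :: "'b \<Rightarrow> 'c"
  assumes K: "topological_group K S" and h: "bij_betw h C (carrier K)"
  defines "K' \<equiv> \<lparr>carrier = C, monoid.mult = (\<lambda>x y. inv_into C h (h x \<otimes>\<^bsub>K\<^esub> h y)),
                   one = inv_into C h \<one>\<^bsub>K\<^esub>\<rparr>"
    and "S' \<equiv> pullback_topology C h S"
  shows "topological_group K' S'" "h \<in> hom K' K" "inv_into C h \<in> hom K K'"
    "continuous_map S' S h" "continuous_map S S' (inv_into C h)"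
proof -
  interpret K: topological_group K S by fact
  let ?g = "inv_into C h"
  have hC: "h x \<in> carrier K" if "x \<in> C" for x using h that by (auto simp: bij_betw_def)
  have gC: "?g y \<in> C" if "y \<in> carrier K" for y
    using h that by (metis bij_betw_def inv_into_into)
  have gh [simp]: "?g (h x) = x" if "x \<in> C" for x using h that by (simp add: bij_betw_def)
  have hg [simp]: "h (?g y) = y" if "y \<in> carrier K" for y
    using h that by (metis bij_betw_def f_inv_into_f)
  have mult: "x \<otimes>\<^bsub>K'\<^esub> y = ?g (h x \<otimes>\<^bsub>K\<^esub> h y)" for x y by (simp add: K'_def)
  have carr [simp]: "carrier K' = C" by (simp add: K'_def)
  have one: "\<one>\<^bsub>K'\<^esub> = ?g \<one>\<^bsub>K\<^esub>" by (simp add: K'_def)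
  have grp: "group K'"
  proof (rule groupI)
    show "\<exists>y\<in>carrier K'. y \<otimes>\<^bsub>K'\<^esub> x = \<one>\<^bsub>K'\<^esub>" if "x \<in> carrier K'" for x
      by (rule bexI[of _ "?g (inv\<^bsub>K\<^esub> h x)"]) (use that hC gC in \<open>simp_all add: mult one\<close>)
  qed (use hC gC in \<open>simp_all add: mult one K.m_assoc\<close>)
  have minv: "inv\<^bsub>K'\<^esub> x = ?g (inv\<^bsub>K\<^esub> h x)" if "x \<in> C" for x
    by (rule group.inv_equality[OF grp]) (use that hC gC in \<open>simp_all add: mult one\<close>)
  show homh: "h \<in> hom K' K" using hC by (auto simp: hom_def mult)
  show "?g \<in> hom K K'" using gC by (auto simp: hom_def mult)
  have top: "topspace S' = C"
    using hC by (auto simp: S'_def topspace_pullback_topology K.topspace_eq_carrier)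
  show ch: "continuous_map S' S h"
    using continuous_map_pullback[OF continuous_map_id[of S], of C h] by (simp add: S'_def)
  show cg: "continuous_map S S' ?g"
    unfolding S'_def
  proof (rule continuous_map_pullback')
    show "continuous_map S S (h \<circ> ?g)"
      by (rule continuous_map_eq[OF continuous_map_id]) (simp add: K.topspace_eq_carrier)
    show "topspace S \<subseteq> ?g -` C" using gC by (auto simp: K.topspace_eq_carrier)
  qed
  show "topological_group K' S'"
  proof (intro topological_group.intro topological_group_axioms.intro)
    show "group K'" by (fact grp)
    show "topspace S' = carrier K'" by (simp add: top)
    show "Hausdorff_space S'"
      by (rule Hausdorff_space_injective_preimage[OF K.Hausdorff ch])
         (use h in \<open>simp add: top bij_betw_def\<close>)
    have "continuous_map (prod_topology S' S') (prod_topology S S) (\<lambda>p. (h (fst p), h (snd p)))"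
      using continuous_map_compose[OF continuous_map_fst ch, of S']
        continuous_map_compose[OF continuous_map_snd ch, of S']
      by (simp add: continuous_map_pairwise o_def)
    from continuous_map_compose[OF continuous_map_compose[OF this K.continuous_mult] cg]
    show "continuous_map (prod_topology S' S') S' (\<lambda>(x, y). x \<otimes>\<^bsub>K'\<^esub> y)"
      by (simp add: o_def mult case_prod_unfold)
    from continuous_map_compose[OF continuous_map_compose[OF ch K.continuous_inv] cg]
    show "continuous_map S' S' (\<lambda>x. inv\<^bsub>K'\<^esub> x)"
      by (rule continuous_map_eq) (simp add: top minv)
  qed
qed

locale bohr =  topological_group X T for X :: "('a, 'm) monoid_scheme" and T
begin

lemma bohr_indexD:
  assumes "i \<in> bohr_index X T"
  shows "topological_group (fst i) (fst (snd i))" "compact_space (fst (snd i))"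
    "snd (snd i) \<in> hom X (fst i)" "continuous_map T (fst (snd i)) (snd (snd i))"
  using assms by (auto simp: bohr_index_def)

lemma topological_group_bohr_product:
  "topological_group (product_group (bohr_index X T) (\<lambda>(K, S, f). K)) (bohr_product_topology X T)"
  unfolding bohr_product_topology_def case_prod_unfold
  by (rule topological_group_product) (rule bohr_indexD)

lemma bohr_map_hom_product:
  "bohr_map X T \<in> hom X (product_group (bohr_index X T) (\<lambda>(K, S, f). K))"
proof (rule homI)
  fix x y assume xy: "x \<in> carrier X" "y \<in> carrier X"
  show "bohr_map X T x \<in> carrier (product_group (bohr_index X T) (\<lambda>(K, S, f). K))"
    using hom_in_carrier[OF bohr_indexD(3) xy(1)] by (simp add: bohr_map_def case_prod_unfold)
  show "bohr_map X T (x \<otimes>\<^bsub>X\<^esub> y) =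
      bohr_map X T x \<otimes>\<^bsub>product_group (bohr_index X T) (\<lambda>(K, S, f). K)\<^esub> bohr_map X T y"
    using hom_mult[OF bohr_indexD(3) xy]
    by (auto simp: bohr_map_def case_prod_unfold intro!: restrict_ext)
qed

lemma continuous_bohr_map_product: "continuous_map T (bohr_product_topology X T) (bohr_map X T)"
  using bohr_indexD(4)
  by (auto simp: bohr_product_topology_def bohr_map_def case_prod_unfold continuous_map_componentwise)

lemma subgroup_bohr_carrier:
  "subgroup (bohr_carrier X T) (product_group (bohr_index X T) (\<lambda>(K, S, f). K))"
  unfolding bohr_carrier_def
proof (rule closure_of_subgroup[OF topological_group_bohr_product])
  interpret group_hom X "product_group (bohr_index X T) (\<lambda>(K, S, f). K)" "bohr_map X T"
    using topological_group_bohr_product bohr_map_hom_product group_axioms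
    by (simp add: group_hom_def group_hom_axioms_def topological_group_def)
  show "subgroup (bohr_map X T ` carrier X) (product_group (bohr_index X T) (\<lambda>(K, S, f). K))"
    by (rule img_is_subgroup)
qed

theorem topological_group_bohr: "topological_group (bohr_group X T) (bohr_topology X T)"
  unfolding bohr_group_def bohr_topology_def
  by (rule topological_group_subgroup[OF topological_group_bohr_product subgroup_bohr_carrier])

theorem compact_bohr: "compact_space (bohr_topology X T)"
proof -
  have "compact_space (bohr_product_topology X T)"
    using bohr_indexD(2)
    by (auto simp: bohr_product_topology_def compact_space_product_topology case_prod_unfold)
  then show ?thesis
    by (simp add: bohr_topology_def bohr_carrier_def closedin_compact_space compact_space_subtopology)
qed

lemma carrier_bohr_group: "carrier (bohr_group X T) = bohr_carrier X T"
  by (simp add: bohr_group_def)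

lemma bohr_map_in: "bohr_map X T ` carrier X \<subseteq> bohr_carrier X T"
  unfolding bohr_carrier_def
  by (rule closure_of_subset)
     (use continuous_bohr_map_product in
       \<open>auto simp: continuous_map_def topspace_eq_carrier Pi_iff\<close>)

theorem bohr_map_hom: "bohr_map X T \<in> hom X (bohr_group X T)"
  using bohr_map_hom_product bohr_map_in by (auto simp: bohr_group_def hom_def)

theorem continuous_bohr_map: "continuous_map T (bohr_topology X T) (bohr_map X T)"
  unfolding bohr_topology_def
  by (rule continuous_map_into_subtopology[OF continuous_bohr_map_product])
     (use bohr_map_in in \<open>auto simp: topspace_eq_carrier\<close>)

theorem dense_bohr_map:
  "bohr_topology X T closure_of (bohr_map X T ` carrier X) = carrier (bohr_group X T)"
  using bohr_map_in
  by (simp add: bohr_topology_def bohr_group_def closure_of_subtopology Int_absorb1)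
     (simp add: bohr_carrier_def)

theorem bohr_universal:
  fixes K :: "('c, 'k) monoid_scheme"
  assumes K: "topological_group K S" and S: "compact_space S"
    and f: "f \<in> hom X K" and cf: "continuous_map T S f"
  shows "\<exists>g. g \<in> hom (bohr_group X T) K \<and> continuous_map (bohr_topology X T) S g \<and>
           (\<forall>x\<in>carrier X. g (bohr_map X T x) = f x)"
proof -
  interpret K: topological_group K S by fact
  define L where "L = S closure_of (f ` carrier X)"
  interpret fh: group_hom X K f
    using f by (simp add: group_hom_def group_hom_axioms_def group_axioms K.group_axioms)
  have L: "subgroup L K"
    unfolding L_def by (rule closure_of_subgroup[OF K]) (rule fh.img_is_subgroup)
  have fL: "f x \<in> L" if "x \<in> carrier X" for x
    using that closure_of_subset[of "f ` carrier X" S] fh.hom_closed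
    by (auto simp: L_def K.topspace_eq_carrier image_subset_iff)
  define e where "e k = {{x \<in> carrier X. f x \<in> U} | U. openin S U \<and> k \<in> U}" for k
  have sep: "k \<notin> L \<or> k' \<notin> L" if "k \<noteq> k'" "e k = e k'" for k k'
  proof (rule ccontr)
    assume "\<not> ?thesis"
    then have kk: "k \<in> L" "k' \<in> L" by auto
    have "L \<subseteq> topspace S" by (simp add: L_def closure_of_subset_topspace)
    with kk that K.Hausdorff obtain U V where
      UV: "openin S U" "openin S V" "k \<in> U" "k' \<in> V" "disjnt U V"
      unfolding Hausdorff_space_def by (metis subsetD)
    have "{x \<in> carrier X. f x \<in> U} \<in> e k'" using UV that(2) unfolding e_def by blast
    then obtain W where W: "openin S W" "k' \<in> W"
      "{x \<in> carrier X. f x \<in> U} = {x \<in> carrier X. f x \<in> W}" by (auto simp: e_def)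
    have "openin S (W \<inter> V)" "k' \<in> W \<inter> V" using W UV by auto
    then obtain x where "x \<in> carrier X" "f x \<in> W \<inter> V"
      using kk(2) unfolding L_def in_closure_of by blast
    then show False using W(3) UV(5) by (auto simp: disjnt_iff)
  qed
  then have inj: "inj_on e L" by (auto simp: inj_on_def)
  define C where "C = e ` L"
  define h where "h = inv_into L e"
  let ?KL = "K\<lparr>carrier := L\<rparr>" and ?SL = "subtopology S L"
  have KL: "topological_group ?KL ?SL" by (rule topological_group_subgroup[OF K L])
  have bij: "bij_betw h C (carrier ?KL)"
    using bij_betw_inv_into[OF inj_on_imp_bij_betw[OF inj]] by (simp add: h_def C_def)
  define K' where "K' = \<lparr>carrier = C, monoid.mult = (\<lambda>x y. inv_into C h (h x \<otimes>\<^bsub>?KL\<^esub> h y)),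
                   one = inv_into C h \<one>\<^bsub>?KL\<^esub>\<rparr>"
  define S' where "S' = pullback_topology C h ?SL"
  note tr = topological_group_transport[OF KL bij, folded K'_def S'_def]
  let ?u = "inv_into C h"
  have SL: "compact_space ?SL"
    using S by (simp add: L_def closedin_compact_space compact_space_subtopology)
  have tSL: "topspace ?SL = L"
    using subgroup.subset[OF L] by (simp add: K.topspace_eq_carrier Int_absorb1)
  have "?u ` L = C"
    using bij_betw_inv_into[OF bij] by (simp add: bij_betw_def)
  moreover have "topspace S' = C"
    using topological_group.topspace_eq_carrier[OF tr(1)] by (simp add: K'_def)
  ultimately have "compact_space S'"
    using image_compactin[OF _ tr(5), of L] SL tSL by (simp add: compact_space_def)
  moreover have "?u \<circ> f \<in> hom X K'"
  proof (rule Group.hom_compose[OF _ tr(3)])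
    show "f \<in> hom X ?KL" using fL fh.hom_mult by (auto simp: hom_def)
  qed
  moreover have "continuous_map T S' (?u \<circ> f)"
    by (rule continuous_map_compose[OF _ tr(5)])
       (rule continuous_map_into_subtopology[OF cf], use fL in \<open>auto simp: topspace_eq_carrier\<close>)
  ultimately have idx: "(K', S', ?u \<circ> f) \<in> bohr_index X T"
    using tr(1) by (simp add: bohr_index_def)
  let ?i = "(K', S', ?u \<circ> f)"
  define g where "g = (\<lambda>p. h (p ?i))"
  have proj: "p ?i \<in> carrier K'" if "p \<in> carrier (bohr_group X T)" for p
  proof -
    have "p \<in> carrier (product_group (bohr_index X T) (\<lambda>(K, S, f). K))"
      using subsetD[OF subgroup.subset[OF subgroup_bohr_carrier], of p] that
      by (simp only: carrier_bohr_group)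
    then have "p \<in> (\<Pi>\<^sub>E i\<in>bohr_index X T. carrier (fst i))"
      by (simp only: carrier_product_group case_prod_unfold)
    from PiE_mem[OF this idx] show ?thesis by simp
  qed
  have hL: "h c \<in> L" if "c \<in> C" for c using bij that by (auto simp: bij_betw_def)
  have "g \<in> hom (bohr_group X T) K"
  proof (rule homI)
    fix p q assume pq: "p \<in> carrier (bohr_group X T)" "q \<in> carrier (bohr_group X T)"
    show "g p \<in> carrier K"
      using subsetD[OF subgroup.subset[OF L] hL[of "p ?i"]] proj[OF pq(1)]
      by (simp add: g_def K'_def)
    have "(p \<otimes>\<^bsub>bohr_group X T\<^esub> q) ?i = p ?i \<otimes>\<^bsub>K'\<^esub> q ?i"
      using idx by (simp add: bohr_group_def product_group_def)
    then show "g (p \<otimes>\<^bsub>bohr_group X T\<^esub> q) = g p \<otimes>\<^bsub>K\<^esub> g q"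
      using hom_mult[OF tr(2) proj[OF pq(1)] proj[OF pq(2)]] by (simp add: g_def)
  qed
  moreover have "continuous_map (bohr_topology X T) S g"
  proof -
    have "continuous_map (bohr_topology X T) S' (\<lambda>p. p ?i)"
      using continuous_map_from_subtopology
          [OF continuous_map_product_projection[OF idx, of "\<lambda>(K, S, f). S"], of "bohr_carrier X T"]
      by (simp only: bohr_topology_def bohr_product_topology_def prod.case)
    from continuous_map_compose[OF this tr(4)] show ?thesis
      by (simp add: g_def o_def continuous_map_in_subtopology)
  qed
  moreover have "g (bohr_map X T x) = f x" if "x \<in> carrier X" for x
  proof -
    have "f x \<in> h ` C" using fL[OF that] bij by (simp add: bij_betw_def)
    then show ?thesis using idx by (simp add: g_def bohr_map_def f_inv_into_f)
  qed
  ultimately show ?thesis by (intro exI[of _ g] conjI ballI) simp_all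
qed

end

end

theory Submission
  imports Defs
begin

text \<open>By the \<open>SB\<close>-property a functionally bounded subset \<open>E\<close> of \<open>X\<^sup>+\<close> is precompact in \<open>X\<close>:
  otherwise \<open>E\<close> contains a sequence that is uniformly discrete in \<open>X\<close>, and a locally finite family of
  translates of one bump function around its members gives a continuous function on \<open>X\<close> that is
  unbounded on it. If \<open>E\<close> is also closed, Raikov completeness makes it compact in \<open>X\<close>. So the closure in
  \<open>X\<^sup>+\<close> of a functionally bounded set is compact in both topologies, which then agree on it. Each
  of the properties in (i) implies functional boundedness and depends on the subspace topology only.\<close>

section \<open>Ultrafilters\<close>

text \<open>Zorn's lemma for the proper filters below \<open>F\<close>, ordered so that a maximal
  element is a finest filter. Such an \<open>M\<close> decides every \<open>P\<close>: its
  restriction to \<open>P\<close> is either trivial or, by minimality, \<open>M\<close>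
  itself.\<close>

lemma ex_ultrafilter_le:
  fixes F :: "'b filter"
  assumes "F \<noteq> bot"
  obtains M where "M \<noteq> bot" "M \<le> F" "\<And>P. eventually P M \<or> eventually (\<lambda>x. \<not> P x) M"
proof -
  define A where "A = {G. G \<noteq> bot \<and> G \<le> F}"
  have "\<exists>M\<in>A. \<forall>G\<in>A. G \<le> M \<longrightarrow> G = M"
  proof (rule predicate_Zorn)
    show "partial_order_on A (relation_of (\<lambda>G H. H \<le> G) A)"
      by (auto simp: partial_order_on_def preorder_on_def refl_on_def trans_def antisym_def relation_of_def)
    fix C assume C: "C \<in> Chains (relation_of (\<lambda>G H. H \<le> G) A)"
    show "\<exists>L\<in>A. \<forall>G\<in>C. L \<le> G"
    proof (cases "C = {}")
      case True
      then show ?thesis using assms by (auto simp: A_def)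
    next
      case False
      have sub: "C \<subseteq> A" and lin: "\<And>G H. G \<in> C \<Longrightarrow> H \<in> C \<Longrightarrow> G \<le> H \<or> H \<le> G"
        using C by (auto simp: Chains_def relation_of_def)
      \<comment> \<open>In a chain, whatever holds eventually for the infimum already does so for a
        single member; hence an infimum of proper filters is proper.\<close>
      have "eventually (\<lambda>_. False) (Inf C) \<longleftrightarrow> (\<exists>G\<in>C. eventually (\<lambda>_. False) G)"
      proof (rule eventually_Inf_base[OF False])
        show "\<exists>L\<in>C. L \<le> inf G H" if "G \<in> C" "H \<in> C" for G H
          using lin[OF that] that by (auto simp: inf_absorb1 inf_absorb2 intro: bexI[of _ G] bexI[of _ H])
      qed
      then have "Inf C \<noteq> bot"
        using sub by (auto simp: A_def trivial_limit_def)
      moreover obtain G where "G \<in> C" using False by blast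
      then have "Inf C \<le> F"
        using sub by (auto simp: A_def intro: Inf_lower2)
      ultimately show ?thesis by (auto simp: A_def intro: Inf_lower)
    qed
  qed
  then obtain M where M: "M \<in> A" and min: "\<And>G. G \<in> A \<Longrightarrow> G \<le> M \<Longrightarrow> G = M" by blast
  have "eventually P M \<or> eventually (\<lambda>x. \<not> P x) M" for P
  proof (rule disjCI)
    assume "\<not> eventually (\<lambda>x. \<not> P x) M"
    then have "inf M (principal {x. P x}) \<noteq> bot"
      by (simp add: trivial_limit_def eventually_inf_principal)
    then have eq: "inf M (principal {x. P x}) = M"
      using M by (intro min) (auto simp: A_def intro: le_infI1)
    show "eventually P M"
      by (subst eq[symmetric]) (simp add: eventually_inf_principal)
  qed
  then show thesis using M that by (auto simp: A_def)
qed

text \<open>Selects one member of a finite cover that the ultrafilter contains; for covers by small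
  translates this yields the Cauchy condition.\<close>

lemma ultrafilter_finite_cover:
  assumes "M \<noteq> bot" "\<And>P. eventually P M \<or> eventually (\<lambda>x. \<not> P x) M"
    and "finite F" "eventually (\<lambda>y. \<exists>x\<in>F. P x y) M"
  shows "\<exists>x\<in>F. eventually (P x) M"
proof (rule ccontr)
  assume "\<not> ?thesis"
  then have "\<forall>x\<in>F. eventually (\<lambda>y. \<not> P x y) M" using assms(2) by blast
  then have "eventually (\<lambda>y. \<forall>x\<in>F. \<not> P x y) M"
    by (intro eventually_ball_finite assms(3))
  with assms(4) have "eventually (\<lambda>y. False) M" by eventually_elim blast
  then show False using assms(1) by simp
qed

text \<open>Closed sets with the finite intersection property relative to \<open>K\<close> generate,
  together with \<open>K\<close>, a proper filter. The limit of an ultrafilter below it lies in each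
  of them because they are closed.\<close>

lemma compactin_if_ultrafilters_converge:
  assumes K: "closedin X K"
    and lim: "\<And>M. \<lbrakk>M \<noteq> bot; \<And>P. eventually P M \<or> eventually (\<lambda>x. \<not> P x) M; eventually (\<lambda>x. x \<in> K) M\<rbrakk>
                \<Longrightarrow> \<exists>l. limitin X (\<lambda>x. x) l M"
  shows "compactin X K"
  unfolding compactin_fip
proof (intro conjI allI impI)
  show "K \<subseteq> topspace X" using K by (rule closedin_subset)
  fix \<U> assume \<U>: "(\<forall>C\<in>\<U>. closedin X C) \<and> (\<forall>\<F>. finite \<F> \<and> \<F> \<subseteq> \<U> \<longrightarrow> K \<inter> \<Inter>\<F> \<noteq> {})"
  define F where "F = (INF C\<in>insert K \<U>. principal C)"
  have "F \<noteq> bot"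
    unfolding F_def
  proof (rule INF_filter_not_bot)
    fix \<F> assume "\<F> \<subseteq> insert K \<U>" "finite \<F>"
    then have "K \<inter> \<Inter>(\<F> - {K}) \<noteq> {}" using \<U> by blast
    then have "\<Inter>\<F> \<noteq> {}" by blast
    then show "(INF C\<in>\<F>. principal C) \<noteq> bot"
      using \<open>finite \<F>\<close> by (simp add: INF_principal_finite principal_eq_bot_iff)
  qed
  then obtain M where M: "M \<noteq> bot" "M \<le> F" "\<And>P. eventually P M \<or> eventually (\<lambda>x. \<not> P x) M"
    using ex_ultrafilter_le by blast
  have ev: "eventually (\<lambda>x. x \<in> C) M" if "C \<in> insert K \<U>" for C
  proof -
    have "M \<le> principal C" using M(2) that unfolding F_def by (meson INF_lower order_trans)
    then show ?thesis by (simp add: le_principal)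
  qed
  obtain l where l: "limitin X (\<lambda>x. x) l M" using lim[OF M(1,3)] ev by blast
  have "l \<in> C" if "C \<in> insert K \<U>" for C
  proof (rule limitin_closedin[OF l _ ev[OF that] M(1)])
    show "closedin X C" using that K \<U> by auto
  qed
  then show "K \<inter> \<Inter>\<U> \<noteq> {}" by blast
qed

section \<open>Compact-like sets and functional boundedness\<close>

lemma functionally_bounded_image:
  assumes "functionally_bounded Y E" "continuous_map Y Z f"
  shows "functionally_bounded Z (f ` E)"
  unfolding functionally_bounded_def
proof (intro conjI allI impI)
  show "f ` E \<subseteq> topspace Z"
    using assms continuous_map_image_subset_topspace[OF assms(2)]
    by (auto simp: functionally_bounded_def)
  fix g assume "continuous_map Z euclideanreal g"
  then show "bounded (g ` f ` E)"
    using assms(1) continuous_map_compose[OF assms(2)]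
    by (metis functionally_bounded_def image_comp)
qed

lemma functionally_bounded_subset:
  "\<lbrakk>functionally_bounded Y E; D \<subseteq> E\<rbrakk> \<Longrightarrow> functionally_bounded Y D"
  unfolding functionally_bounded_def by (meson bounded_subset image_mono order_trans)

lemma functionally_bounded_closure_of:
  assumes "functionally_bounded Y E"
  shows "functionally_bounded Y (Y closure_of E)"
  unfolding functionally_bounded_def
proof (intro conjI allI impI)
  show "Y closure_of E \<subseteq> topspace Y" by (rule closure_of_subset_topspace)
  fix f assume f: "continuous_map Y euclideanreal f"
  have "f ` (Y closure_of E) \<subseteq> closure (f ` E)"
    using continuous_map_image_closure_subset[OF f] by simp
  then show "bounded (f ` (Y closure_of E))"
    using assms f by (meson bounded_closure bounded_subset functionally_bounded_def)
qed

lemma compactin_imp_functionally_bounded: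
  "compactin Y E \<Longrightarrow> functionally_bounded Y E"
  using image_compactin[of Y E euclideanreal]
  by (auto simp: functionally_bounded_def compactin_subset_topspace compact_imp_bounded)

lemma pseudocompact_imp_functionally_bounded:
  "E \<in> pseudocompact_sets Y \<Longrightarrow> functionally_bounded Y E"
  by (auto simp: pseudocompact_sets_def functionally_bounded_def continuous_map_from_subtopology)

lemma unbounded_real_sequence:
  fixes f :: "'b \<Rightarrow> real"
  assumes "\<not> bounded (f ` A)"
  obtains s :: "nat \<Rightarrow> 'b" where "range s \<subseteq> A" "\<And>n. real n < \<bar>f (s n)\<bar>"
proof -
  have "\<exists>x\<in>A. real n < \<bar>f x\<bar>" for n
    using assms by (force simp: bounded_real not_le)
  then obtain s where "\<And>n. s n \<in> A \<and> real n < \<bar>f (s n)\<bar>" by metis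
  then show thesis using that[of s] by auto
qed

text \<open>If \<open>f\<close> is unbounded, choose \<open>s\<close> with
  \<open>n < \<bar>f (s n)\<bar>\<close>. Since \<open>n \<le> r n\<close>, this growth survives in
  every subsequence, while the values along a convergent one are bounded.\<close>

lemma sequentially_compact_imp_functionally_bounded:
  assumes "E \<in> sequentially_compact_sets Y"
  shows "functionally_bounded Y E"
  unfolding functionally_bounded_def
proof (intro conjI allI impI)
  show "E \<subseteq> topspace Y" using assms by (simp add: sequentially_compact_sets_def)
  fix f assume f: "continuous_map Y euclideanreal f"
  show "bounded (f ` E)"
  proof (rule ccontr)
    assume "\<not> bounded (f ` E)"
    then obtain s where s: "range s \<subseteq> E" "\<And>n. real n < \<bar>f (s n)\<bar>"
      using unbounded_real_sequence by blast
    then obtain l r where r: "strict_mono (r :: nat \<Rightarrow> nat)" and l: "limitin Y (s \<circ> r) l sequentially"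
      using assms unfolding sequentially_compact_sets_def by blast
    have "(f \<circ> (s \<circ> r)) \<longlonglongrightarrow> f l"
      using continuous_map_limit[OF f l] by simp
    then obtain B where B: "\<And>n. \<bar>f (s (r n))\<bar> \<le> B"
      by (metis Bseq_def convergentI convergent_imp_Bseq comp_apply real_norm_def)
    obtain n where "B < real n" using reals_Archimedean2 by blast
    also have "real n \<le> real (r n)" using seq_suble[OF r] by simp
    finally show False using s(2)[of "r n"] B[of n] by simp
  qed
qed

lemma countably_compact_imp_functionally_bounded:
  assumes E: "E \<in> countably_compact_sets Y" and Y: "Hausdorff_space Y"
  shows "functionally_bounded Y E"
  unfolding functionally_bounded_def
proof (intro conjI allI impI)
  show "E \<subseteq> topspace Y" using E by (simp add: countably_compact_sets_def)
  fix f assume f: "continuous_map Y euclideanreal f"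
  show "bounded (f ` E)"
  proof (rule ccontr)
    assume "\<not> bounded (f ` E)"
    then obtain s where s: "range s \<subseteq> E" "\<And>n. real n < \<bar>f (s n)\<bar>"
      using unbounded_real_sequence by blast
    have "infinite (range s)"
    proof
      assume "finite (range s)"
      then have "bounded (f ` range s)" by (simp add: finite_imp_bounded)
      then obtain B where "\<And>n. \<bar>f (s n)\<bar> \<le> B" by (auto simp: bounded_real)
      then show False using s(2) by (metis less_le_not_le order_trans reals_Archimedean2 linear)
    qed
    moreover have "countable (range s)" by simp
    ultimately have "E \<inter> Y derived_set_of (range s) \<noteq> {}"
      using E s(1) unfolding countably_compact_sets_def by blast
    then obtain a where a: "a \<in> Y derived_set_of (range s)" by blast
    \<comment> \<open>On \<open>U\<close> the values of \<open>f\<close> stay within 1 of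
      \<open>f a\<close>, so only finitely many terms of \<open>s\<close> lie there. In a Hausdorff
      space, however, a neighbourhood of an accumulation point contains infinitely many.\<close>
    define U where "U = {x \<in> topspace Y. f x \<in> ball (f a) 1}"
    have "openin Y U"
      unfolding U_def by (rule openin_continuous_map_preimage[OF f]) simp
    moreover have "a \<in> U" using a by (simp add: U_def in_derived_set_of)
    ultimately have "infinite (U \<inter> range s)"
      using a by (simp add: derived_set_of_infinite_openin[OF Y] Int_commute)
    moreover obtain m where m: "\<bar>f a\<bar> + 1 < real m" using reals_Archimedean2 by blast
    have "U \<inter> range s \<subseteq> s ` {..<m}"
    proof
      fix x assume "x \<in> U \<inter> range s"
      then obtain n where x: "x = s n" "\<bar>f a - f (s n)\<bar> < 1" by (auto simp: U_def dist_real_def)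
      then have "real n < real m" using s(2)[of n] m by linarith
      then show "x \<in> s ` {..<m}" using x by simp
    qed
    ultimately show False using finite_subset by blast
  qed
qed

lemma convergent_sequence_imp_compactin:
  assumes "E \<in> convergent_sequence_sets Y"
  shows "compactin Y E"
proof -
  obtain s l where E: "E = range s \<union> {l}" and s: "range s \<subseteq> topspace Y" "limitin Y s l sequentially"
    using assms by (auto simp: convergent_sequence_sets_def)
  have "insert l (range s) = E" using E by auto
  then show ?thesis using compactin_sequence_with_limit[OF s(2) order_refl s(1)] by simp
qed

section \<open>Uniformly discrete sequences\<close>

text \<open>For functions that have a simple formula near each point but no global one, such as the
  sum of bumps \<open>g\<close> below.\<close>

lemma continuous_map_locally:
  assumes "\<And>x. x \<in> topspace X \<Longrightarrow>
      \<exists>N h. openin X N \<and> x \<in> N \<and> continuous_map X Y h \<and> (\<forall>y\<in>N. g y = h y)"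
  shows "continuous_map X Y g"
proof -
  obtain N h where Nh: "\<And>x. x \<in> topspace X \<Longrightarrow>
      openin X (N x) \<and> x \<in> N x \<and> continuous_map X Y (h x) \<and> (\<forall>y\<in>N x. g y = h x y)"
    using assms by metis
  show ?thesis
  proof (rule pasting_lemma[where I = "topspace X" and T = N and f = h])
    show "continuous_map (subtopology X (N x)) Y (h x)" if "x \<in> topspace X" for x
      using Nh[OF that] continuous_map_from_subtopology by blast
  qed (use Nh in \<open>auto, metis\<close>)
qed

lemma (in group) mult_inv_cancel:
  assumes "x \<in> carrier G" "y \<in> carrier G"
  shows "x \<otimes> (inv x \<otimes> y) = y" "inv x \<otimes> (x \<otimes> y) = y"
  using assms by (simp_all flip: m_assoc)

section \<open>Neighbourhoods of the identity and bump functions\<close>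

context topological_group
begin

text \<open>Continuity of multiplication at the identity gives a box inside the preimage of
  \<open>U\<close>; intersecting with a preimage under inversion makes the neighbourhood
  symmetric.\<close>

lemma one_nbhd_sqrt:
  assumes U: "openin T U" "\<one> \<in> U"
  obtains V where "openin T V" "\<one> \<in> V" "\<And>x. x \<in> V \<Longrightarrow> inv x \<in> V"
    "\<And>x y. \<lbrakk>x \<in> V; y \<in> V\<rbrakk> \<Longrightarrow> x \<otimes> y \<in> U"
proof -
  define S where "S = {p \<in> topspace (prod_topology T T). (\<lambda>(x, y). x \<otimes> y) p \<in> U}"
  have S: "openin (prod_topology T T) S"
    unfolding S_def by (rule openin_continuous_map_preimage[OF continuous_mult U(1)])
  have "(\<one>, \<one>) \<in> S" using U(2) by (simp add: S_def topspace_eq_carrier)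
  then obtain A B where AB: "openin T A" "openin T B" "\<one> \<in> A" "\<one> \<in> B" "A \<times> B \<subseteq> S"
    using iffD1[OF openin_prod_topology_alt S, THEN spec[of _ "\<one>"], THEN spec[of _ "\<one>"]]
    by (elim impE exE conjE)
  define V where "V = (A \<inter> B) \<inter> {x \<in> topspace T. inv x \<in> A \<inter> B}"
  have V: "V \<subseteq> carrier G" by (auto simp: V_def topspace_eq_carrier)
  show thesis
  proof
    show "openin T V"
      unfolding V_def using AB openin_continuous_map_preimage[OF continuous_inv] by blast
    show "\<one> \<in> V" using AB by (simp add: V_def topspace_eq_carrier)
    show "inv x \<in> V" if "x \<in> V" for x
      using that V by (auto simp: V_def topspace_eq_carrier)
    show "x \<otimes> y \<in> U" if "x \<in> V" "y \<in> V" for x y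
      using that AB(5) by (auto simp: V_def S_def)
  qed
qed

lemma continuous_map_left_mult:
  assumes "a \<in> carrier G"
  shows "continuous_map T T (\<lambda>x. a \<otimes> x)"
proof -
  have "continuous_map T (prod_topology T T) (\<lambda>x. (a, x))"
    using assms by (simp add: continuous_map_pairwise o_def topspace_eq_carrier)
  from continuous_map_compose[OF this continuous_mult] show ?thesis by (simp add: o_def)
qed

lemma openin_left_translate:
  assumes "a \<in> carrier G" "openin T U"
  shows "openin T {x \<in> carrier G. inv a \<otimes> x \<in> U}"
  using openin_continuous_map_preimage[OF continuous_map_left_mult assms(2)] assms(1)
  by (simp add: topspace_eq_carrier)

text \<open>The hypothesis is uniform continuity for the left uniformity; the required neighbourhood
  of \<open>x\<close> is the translate of \<open>W\<close> by \<open>x\<close>.\<close>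

lemma continuous_map_real_translates:
  fixes f :: "'a \<Rightarrow> real"
  assumes "\<And>e. e > 0 \<Longrightarrow>
      \<exists>W. openin T W \<and> \<one> \<in> W \<and> (\<forall>x\<in>carrier G. \<forall>w\<in>W. \<bar>f (x \<otimes> w) - f x\<bar> < e)"
  shows "continuous_map T euclideanreal f"
  unfolding Met_TC.continuous_map_to_metric[of T f, unfolded mtopology_is_euclidean]
proof (intro ballI allI impI)
  fix x and e :: real assume x: "x \<in> topspace T" and "e > 0"
  then obtain W where W: "openin T W" "\<one> \<in> W" "\<forall>x\<in>carrier G. \<forall>w\<in>W. \<bar>f (x \<otimes> w) - f x\<bar> < e"
    using assms by metis
  have xG: "x \<in> carrier G" using x by (simp add: topspace_eq_carrier)
  have "f y \<in> ball (f x) e" if "y \<in> carrier G" "inv x \<otimes> y \<in> W" for y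
  proof -
    have "\<bar>f (x \<otimes> (inv x \<otimes> y)) - f x\<bar> < e" using W(3) xG that by blast
    then show ?thesis using xG that by (simp add: m_assoc[symmetric] dist_real_def)
  qed
  then show "\<exists>U. openin T U \<and> x \<in> U \<and> (\<forall>y\<in>U. f y \<in> Met_TC.mball (f x) e)"
    using openin_left_translate[OF xG W(1)] xG W(2)
    by (intro exI[of _ "{y \<in> carrier G. inv x \<otimes> y \<in> W}"]) auto
qed

text \<open>Urysohn's construction for the relation \<open>A W \<subseteq> B\<close> for some neighbourhood \<open>W\<close> of the identity,
  in place of the inclusion of the closure of \<open>A\<close> in \<open>B\<close>.\<close>

lemma ex_bump_function:
  assumes U: "openin T U" "\<one> \<in> U"
  obtains f :: "'a \<Rightarrow> real" where "continuous_map T euclideanreal f" "f \<one> = 1"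
    "\<And>x. x \<in> carrier G - U \<Longrightarrow> f x = 0"
proof -
  define R where "R A B \<longleftrightarrow> A \<subseteq> carrier G \<and> B \<subseteq> carrier G \<and>
      (\<exists>W. openin T W \<and> \<one> \<in> W \<and> (\<forall>x\<in>A. \<forall>w\<in>W. x \<otimes> w \<in> B))" for A B
  have carr: "W \<subseteq> carrier G" if "openin T W" for W
    using openin_subset[OF that] by (simp add: topspace_eq_carrier)
  have R_subset: "A \<subseteq> B" if "R A B" for A B
    using that by (fastforce simp: R_def)
  have "\<exists>H :: real \<Rightarrow> 'a set. H 0 = {\<one>} \<and> H 1 = U \<and>
      (\<forall>x \<in> dyadics \<inter> {0..1}. \<forall>y \<in> dyadics \<inter> {0..1}. x < y \<longrightarrow> R (H x) (H y))"
  proof (rule recursion_on_dyadic_fractions)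
    show "R {\<one>} U"
      unfolding R_def
    proof (intro conjI exI[of _ U])
      show "\<forall>x\<in>{\<one>}. \<forall>w\<in>U. x \<otimes> w \<in> U" using carr[OF U(1)] by (auto simp: subset_iff)
    qed (use U carr in auto)
    show "\<exists>C. R A C \<and> R C B" if R_AB: "R A B" for A B
    proof -
      obtain W where W: "openin T W" "\<one> \<in> W" "\<forall>x\<in>A. \<forall>w\<in>W. x \<otimes> w \<in> B"
        and AB: "A \<subseteq> carrier G" "B \<subseteq> carrier G"
        using R_AB unfolding R_def by blast
      obtain V where V: "openin T V" "\<one> \<in> V" "\<And>x y. \<lbrakk>x \<in> V; y \<in> V\<rbrakk> \<Longrightarrow> x \<otimes> y \<in> W"
        using one_nbhd_sqrt[OF W(1,2)] by metis
      \<comment> \<open>The interpolating set is \<open>A V\<close>: the products of two elements of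
        \<open>V\<close> lie in \<open>W\<close>, so \<open>A V V\<close> is contained in
        \<open>A W\<close> and hence in \<open>B\<close>.\<close>
      have "R A (A <#> V)"
        using AB V carr[OF V(1)] by (auto simp: R_def set_mult_def)
      moreover have "a \<otimes> v \<otimes> w \<in> B" if "a \<in> A" "v \<in> V" "w \<in> V" for a v w
        using bspec[OF bspec[OF W(3) that(1)] V(3)[OF that(2,3)]] that AB carr[OF V(1)]
        by (simp add: m_assoc subset_iff)
      then have "R (A <#> V) B"
        using AB V carr[OF V(1)] unfolding R_def set_mult_def by blast
      ultimately show ?thesis by blast
    qed
    show "R A C" if RR: "R A B" "R B C" for A B C
    proof -
      obtain W where W: "openin T W" "\<one> \<in> W" "\<forall>x\<in>A. \<forall>w\<in>W. x \<otimes> w \<in> B"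
        using RR(1) by (auto simp only: R_def)
      moreover have "\<forall>x\<in>A. \<forall>w\<in>W. x \<otimes> w \<in> C" using W(3) R_subset[OF RR(2)] by blast
      ultimately show ?thesis using RR by (auto simp only: R_def)
    qed
  qed
  then obtain H :: "real \<Rightarrow> 'a set" where H0: "H 0 = {\<one>}" and H1: "H 1 = U"
    and H: "\<And>x y. \<lbrakk>x \<in> dyadics; y \<in> dyadics; 0 \<le> x; x < y; y \<le> 1\<rbrakk> \<Longrightarrow> R (H x) (H y)"
    by (smt (verit, del_insts) Int_iff atLeastAtMost_iff)
  have H_mono: "H x \<subseteq> H y" if "x \<in> dyadics" "y \<in> dyadics" "0 \<le> x" "x \<le> y" "y \<le> 1" for x y
    using H[of x y] R_subset that by (cases "x = y") auto
  \<comment> \<open>The infimum of \<open>D x\<close> is the lowest level reached at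
    \<open>x\<close>. Inserting 1 keeps \<open>D x\<close> nonempty and gives the value 1 outside
    \<open>U\<close>; the bump is therefore \<open>1 - f\<close>.\<close>
  define D where "D x = insert 1 {r. r \<in> dyadics \<inter> {0..1} \<and> x \<in> H r}" for x
  define f where "f x = Inf (D x)" for x
  have bdd: "bdd_below (D x)" for x by (rule bdd_belowI[of _ 0]) (auto simp: D_def)
  have f_le: "f x \<le> r" if "r \<in> D x" for x r
    unfolding f_def by (rule cInf_lower[OF that bdd])
  have f_ge: "0 \<le> f x" for x
    unfolding f_def by (rule cInf_greatest) (auto simp: D_def)
  have dy: "real k / 2 ^ n \<in> dyadics" for k n by (auto simp: dyadics_def)
  have "(0::real) \<in> dyadics" using dy[of 0 0] by simp
  then have "0 \<in> D \<one>" by (simp add: D_def H0)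
  then have f_one: "f \<one> = 0" using f_le[of 0] f_ge[of \<one>] by force
  have f_out: "f x = 1" if "x \<in> carrier G - U" for x
  proof -
    have "D x = {1}"
      using that H_mono[of _ 1] dy[of 1 0] H1 by (force simp: D_def)
    then show ?thesis by (simp add: f_def)
  qed
  \<comment> \<open>One \<open>1 / 2 ^ n\<close> pays for rounding \<open>f x\<close> up to a dyadic
    level, the other for the rise by one level under translation. Intersecting the neighbourhoods of
    the finitely many levels makes \<open>W\<close> independent of \<open>x\<close>.\<close>
  have level: "\<exists>W. openin T W \<and> \<one> \<in> W \<and> (\<forall>x\<in>carrier G. \<forall>w\<in>W. f (x \<otimes> w) \<le> f x + 2 / 2 ^ n)" for n
  proof -
    have "\<exists>W. openin T W \<and> \<one> \<in> W \<and> (\<forall>x\<in>H (real k / 2 ^ n). \<forall>w\<in>W. x \<otimes> w \<in> H (real (Suc k) / 2 ^ n))"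
      if "k < 2 ^ n" for k
    proof -
      have "real (Suc k) \<le> 2 ^ n"
        using that by (metis Suc_leI of_nat_le_iff of_nat_numeral of_nat_power)
      then have "R (H (real k / 2 ^ n)) (H (real (Suc k) / 2 ^ n))"
        using dy[of k n] dy[of "Suc k" n] by (intro H) (auto simp: divide_simps simp del: of_nat_Suc)
      then show ?thesis by (simp add: R_def)
    qed
    then obtain W where W: "\<And>k. k < 2 ^ n \<Longrightarrow> openin T (W k) \<and> \<one> \<in> W k \<and>
        (\<forall>x\<in>H (real k / 2 ^ n). \<forall>w\<in>W k. x \<otimes> w \<in> H (real (Suc k) / 2 ^ n))"
      by metis
    define W' where "W' = (\<Inter>k<2 ^ n. W k)"
    have "openin T W'" unfolding W'_def
      by (rule openin_Inter) (use W in \<open>auto simp: lessThan_empty_iff\<close>)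
    moreover have "\<one> \<in> W'" using W by (simp add: W'_def)
    moreover have "f (x \<otimes> w) \<le> f x + 2 / 2 ^ n" if x: "x \<in> carrier G" and w: "w \<in> W'" for x w
    proof (cases "f x + 2 / 2 ^ n \<ge> 1")
      case True
      then show ?thesis using f_le[of 1 "x \<otimes> w"] by (simp add: D_def)
    next
      case False
      \<comment> \<open>Adding 1 to the floor makes \<open>f x < k / 2 ^ n\<close> strict, so some
        level of \<open>D x\<close> lies below \<open>k / 2 ^ n\<close>. The case assumption leaves
        room for the level \<open>Suc k\<close>.\<close>
      define k where "k = nat (\<lfloor>f x * 2 ^ n\<rfloor> + 1)"
      have "real k = of_int \<lfloor>f x * 2 ^ n\<rfloor> + 1"
        using f_ge[of x] by (simp add: k_def)
      then have k: "f x * 2 ^ n < real k" "real k \<le> f x * 2 ^ n + 1" by linarith+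
      have "f x * 2 ^ n + 2 < 2 ^ n" using False by (simp add: field_simps)
      then have kn: "real (Suc k) < 2 ^ n" using k by simp
      then have "k < 2 ^ n" by (metis Suc_lessD of_nat_less_iff of_nat_numeral of_nat_power)
      have "f x < real k / 2 ^ n" using k by (simp add: field_simps)
      moreover have "D x \<noteq> {}" by (simp add: D_def)
      ultimately obtain r where r: "r \<in> D x" "r < real k / 2 ^ n"
        unfolding f_def by (metis cInf_less_iff[OF _ bdd])
      have "real k \<le> 2 ^ n" using kn by linarith
      then have "real k / 2 ^ n \<le> 1" by (simp add: field_simps)
      then have "x \<in> H (real k / 2 ^ n)"
        using r H_mono[OF _ dy, of r k n] by (auto simp: D_def)
      then have "x \<otimes> w \<in> H (real (Suc k) / 2 ^ n)"
        using W[OF \<open>k < 2 ^ n\<close>] w \<open>k < 2 ^ n\<close> by (auto simp: W'_def)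
      then have "real (Suc k) / 2 ^ n \<in> D (x \<otimes> w)"
        using dy[of "Suc k" n] kn by (auto simp: D_def divide_simps)
      then have "f (x \<otimes> w) \<le> real (Suc k) / 2 ^ n" by (rule f_le)
      also have "\<dots> \<le> (f x * 2 ^ n + 2) / 2 ^ n" using k by (intro divide_right_mono) auto
      also have "\<dots> = f x + 2 / 2 ^ n" by (simp add: add_divide_distrib)
      finally show ?thesis .
    qed
    ultimately show ?thesis by blast
  qed
  have "continuous_map T euclideanreal f"
  proof (rule continuous_map_real_translates)
    fix e :: real assume "e > 0"
    then obtain n where n: "2 / 2 ^ n < e"
      using real_arch_pow_inv[of "e / 2" "1 / 2"] by (auto simp: field_simps power_one_over)
    obtain W where W: "openin T W" "\<one> \<in> W" "\<And>x w. x \<in> carrier G \<Longrightarrow> w \<in> W \<Longrightarrow> f (x \<otimes> w) \<le> f x + 2 / 2 ^ n"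
      using level by metis
    obtain V where V: "openin T V" "\<one> \<in> V" "\<And>x. x \<in> V \<Longrightarrow> inv x \<in> V"
        "\<And>x y. \<lbrakk>x \<in> V; y \<in> V\<rbrakk> \<Longrightarrow> x \<otimes> y \<in> W"
      using one_nbhd_sqrt[OF W(1,2)] by metis
    have VW: "v \<in> W" if "v \<in> V" for v
      using V(4)[OF that V(2)] that carr[OF V(1)] by (simp add: subset_iff)
    have "\<bar>f (x \<otimes> v) - f x\<bar> < e" if x: "x \<in> carrier G" and v: "v \<in> V" for x v
    proof -
      have vG: "v \<in> carrier G" using v carr[OF V(1)] by blast
      \<comment> \<open>The one-sided estimate, applied to \<open>x \<otimes> v\<close> and
        \<open>inv v\<close>, gives the bound from the other side; this is why \<open>V\<close> is
        symmetric.\<close>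
      have "f (x \<otimes> v \<otimes> inv v) \<le> f (x \<otimes> v) + 2 / 2 ^ n"
        using W(3)[of "x \<otimes> v" "inv v"] V(3)[OF v] VW x vG by simp
      then show ?thesis
        using W(3)[OF x VW[OF v]] n x vG by (simp add: m_assoc)
    qed
    then show "\<exists>W. openin T W \<and> \<one> \<in> W \<and> (\<forall>x\<in>carrier G. \<forall>w\<in>W. \<bar>f (x \<otimes> w) - f x\<bar> < e)"
      using V by blast
  qed
  then show thesis
    using that[of "\<lambda>x. 1 - f x"] f_one f_out by (simp add: continuous_intros)
qed

text \<open>Put a bump of height \<open>n\<close> on the translate \<open>s n V\<close>. As fourfold
  products from \<open>V\<close> lie in \<open>U\<close>, each translate \<open>x V\<close> meets at
  most one of these supports, so the bumps add up to a continuous function with value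
  \<open>n\<close> at \<open>s n\<close>.\<close>

lemma uniformly_discrete_not_functionally_bounded:
  assumes s: "range s \<subseteq> carrier G" and U: "openin T U" "\<one> \<in> U"
    and disc: "\<And>m n :: nat. m < n \<Longrightarrow> inv (s m) \<otimes> s n \<notin> U"
  shows "\<not> functionally_bounded T (range s)"
proof -
  obtain W where W: "openin T W" "\<one> \<in> W" "\<And>x y. \<lbrakk>x \<in> W; y \<in> W\<rbrakk> \<Longrightarrow> x \<otimes> y \<in> U"
    using one_nbhd_sqrt[OF U] by metis
  obtain V where V: "openin T V" "\<one> \<in> V" "\<And>x. x \<in> V \<Longrightarrow> inv x \<in> V"
      "\<And>x y. \<lbrakk>x \<in> V; y \<in> V\<rbrakk> \<Longrightarrow> x \<otimes> y \<in> W"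
    using one_nbhd_sqrt[OF W(1,2)] by metis
  obtain f :: "'a \<Rightarrow> real" where f: "continuous_map T euclideanreal f" "f \<one> = 1"
      "\<And>x. x \<in> carrier G - V \<Longrightarrow> f x = 0"
    using ex_bump_function[OF V(1,2)] by metis
  have sG [simp]: "s n \<in> carrier G" for n using s by auto
  \<comment> \<open>Here \<open>y\<close> lies in both \<open>x V\<close> and \<open>s n V\<close>,
    and \<open>z\<close> in both \<open>x V\<close> and \<open>s m V\<close>. The product of four
    elements of \<open>V\<close> below telescopes to \<open>inv (s m) \<otimes> s n\<close>.\<close>
  have le: "\<not> m < n"
    if x: "x \<in> carrier G" and y: "y \<in> carrier G" "inv x \<otimes> y \<in> V" "inv (s n) \<otimes> y \<in> V"
      and z: "z \<in> carrier G" "inv x \<otimes> z \<in> V" "inv (s m) \<otimes> z \<in> V" for x y z m n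
  proof
    assume "m < n"
    have "(inv (s m) \<otimes> z \<otimes> inv (inv x \<otimes> z)) \<otimes> (inv x \<otimes> y \<otimes> inv (inv (s n) \<otimes> y)) \<in> U"
      by (intro W(3) V(3,4) y z)
    moreover have "(inv (s m) \<otimes> z \<otimes> inv (inv x \<otimes> z)) \<otimes> (inv x \<otimes> y \<otimes> inv (inv (s n) \<otimes> y)) = inv (s m) \<otimes> s n"
      using x y z by (simp add: inv_mult_group m_assoc mult_inv_cancel)
    ultimately show False using disc[OF \<open>m < n\<close>] by simp
  qed
  have uniq: "m = n"
    if "x \<in> carrier G" "y \<in> carrier G" "inv x \<otimes> y \<in> V" "inv (s n) \<otimes> y \<in> V"
      "z \<in> carrier G" "inv x \<otimes> z \<in> V" "inv (s m) \<otimes> z \<in> V" for x y z m n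
    using le[OF that] le[OF that(1,5,6,7,2,3,4)] by simp
  \<comment> \<open>At most one summand is nonzero at any point: by \<open>uniq\<close> the index
    chosen by \<open>SOME\<close> is the only candidate.\<close>
  define g where "g x = (if \<exists>n. inv (s n) \<otimes> x \<in> V
      then real (SOME n. inv (s n) \<otimes> x \<in> V) * f (inv (s (SOME n. inv (s n) \<otimes> x \<in> V)) \<otimes> x) else 0)" for x
  have g_eq: "g y = real n * f (inv (s n) \<otimes> y)" if "y \<in> carrier G" "inv (s n) \<otimes> y \<in> V" for y n
  proof -
    have "inv (s (SOME n. inv (s n) \<otimes> y \<in> V)) \<otimes> y \<in> V" using that(2) by (rule someI)
    then have "(SOME n. inv (s n) \<otimes> y \<in> V) = n"
      using uniq[of y y n y "SOME n. inv (s n) \<otimes> y \<in> V"] that V(2) by simp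
    then show ?thesis using that(2) by (auto simp: g_def)
  qed
  have "continuous_map T euclideanreal g"
  proof (rule continuous_map_locally)
    fix x assume "x \<in> topspace T"
    then have x: "x \<in> carrier G" by (simp add: topspace_eq_carrier)
    define N where "N = {y \<in> carrier G. inv x \<otimes> y \<in> V}"
    have N: "openin T N" "x \<in> N"
      using openin_left_translate[OF x V(1)] x V(2) by (auto simp: N_def)
    have "\<exists>h. continuous_map T euclideanreal h \<and> (\<forall>y\<in>N. g y = h y)"
    proof (cases "\<exists>z\<in>N. \<exists>n. inv (s n) \<otimes> z \<in> V")
      case True
      then obtain z n where z: "z \<in> N" "inv (s n) \<otimes> z \<in> V" by blast
      have "continuous_map T euclideanreal (\<lambda>y. real n * f (inv (s n) \<otimes> y))"
        using continuous_map_compose[OF continuous_map_left_mult[of "inv (s n)"] f(1)]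
        by (intro continuous_map_real_mult_left) (simp add: o_def)
      moreover have "g y = real n * f (inv (s n) \<otimes> y)" if "y \<in> N" for y
      proof (cases "\<exists>m. inv (s m) \<otimes> y \<in> V")
        case True
        then obtain m where m: "inv (s m) \<otimes> y \<in> V" by blast
        have "m = n" using uniq[of x z n y m] x z that m by (simp add: N_def)
        then show ?thesis using g_eq m that by (simp add: N_def)
      next
        case False
        \<comment> \<open>Off all the supports the formula with the fixed \<open>n\<close> also
          gives 0, so it represents \<open>g\<close> on the whole of \<open>N\<close>.\<close>
        then have "f (inv (s n) \<otimes> y) = 0" using that by (intro f(3)) (auto simp: N_def)
        then show ?thesis using False by (simp add: g_def)
      qed
      ultimately show ?thesis by blast
    next
      case False
      then show ?thesis by (intro exI[of _ "\<lambda>_. 0"]) (auto simp: g_def)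
    qed
    then show "\<exists>N h. openin T N \<and> x \<in> N \<and> continuous_map T euclideanreal h \<and> (\<forall>y\<in>N. g y = h y)"
      using N by blast
  qed
  moreover have "\<not> bounded (g ` range s)"
  proof
    have "g (s n) = real n" for n using g_eq[of "s n" n] V(2) f(2) by simp
    moreover assume "bounded (g ` range s)"
    ultimately obtain B where "\<And>n. real n \<le> B" by (auto simp: bounded_real)
    then show False by (metis reals_Archimedean2 not_le)
  qed
  ultimately show ?thesis by (auto simp: functionally_bounded_def)
qed

section \<open>Precompactness and Raikov completeness\<close>

text \<open>Without a finite cover one can recursively pick points of \<open>E\<close>, each outside
  the translates of \<open>U\<close> by its predecessors. The resulting sequence is uniformly
  discrete, hence not functionally bounded.\<close>

lemma ex_finite_left_cover:
  assumes E: "E \<subseteq> carrier G" and U: "openin T U" "\<one> \<in> U"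
    and bdd: "\<And>s :: nat \<Rightarrow> 'a. range s \<subseteq> E \<Longrightarrow> functionally_bounded T (range s)"
  shows "\<exists>F. finite F \<and> F \<subseteq> E \<and> (\<forall>y\<in>E. \<exists>x\<in>F. inv x \<otimes> y \<in> U)"
proof (rule ccontr)
  assume no: "\<not> ?thesis"
  have "\<exists>s. \<forall>n::nat. s n \<in> E \<and> (\<forall>m<n. inv (s m) \<otimes> s n \<notin> U)"
  proof (rule dependent_wellorder_choice)
    show "\<exists>y. y \<in> E \<and> (\<forall>m<n. inv (s m) \<otimes> y \<notin> U)"
      if "\<And>k. k < n \<Longrightarrow> s k \<in> E \<and> (\<forall>m<k. inv (s m) \<otimes> s k \<notin> U)" for n :: nat and s
    proof -
      have "finite (s ` {..<n})" "s ` {..<n} \<subseteq> E" using that by auto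
      then show ?thesis using no by (metis imageI lessThan_iff)
    qed
  qed simp
  then obtain s :: "nat \<Rightarrow> 'a" where s: "range s \<subseteq> E" "\<And>m n. m < n \<Longrightarrow> inv (s m) \<otimes> s n \<notin> U"
    by auto
  have "\<not> functionally_bounded T (range s)"
    by (rule uniformly_discrete_not_functionally_bounded[OF order_trans[OF s(1) E] U]) (rule s(2))
  with bdd[OF s(1)] show False by contradiction
qed

text \<open>An ultrafilter on \<open>E\<close> is shown to be Cauchy for the two-sided uniformity.
  Finite left covers of \<open>E\<close> control the left uniformity, and those of the set of
  inverses control the right one; continuity of inversion transfers the hypothesis to
  inverses.\<close>

lemma raikov_complete_compactin:
  assumes complete: "raikov_complete G T" and E: "closedin T E"
    and bdd: "\<And>s :: nat \<Rightarrow> 'a. range s \<subseteq> E \<Longrightarrow> functionally_bounded T (range s)"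
  shows "compactin T E"
proof (rule compactin_if_ultrafilters_converge[OF E])
  fix M :: "'a filter"
  assume M: "M \<noteq> bot" "\<And>P. eventually P M \<or> eventually (\<lambda>x. \<not> P x) M" "eventually (\<lambda>x. x \<in> E) M"
  have EG: "E \<subseteq> carrier G" using closedin_subset[OF E] by (simp add: topspace_eq_carrier)
  have bdd_inv: "functionally_bounded T (range s)" if "range s \<subseteq> m_inv G ` E" for s :: "nat \<Rightarrow> 'a"
  proof -
    have sG: "s n \<in> carrier G" and sE: "inv (s n) \<in> E" for n
    proof -
      obtain x where "x \<in> E" "s n = inv x" using \<open>range s \<subseteq> m_inv G ` E\<close> by blast
      then show "s n \<in> carrier G" "inv (s n) \<in> E" using EG by auto
    qed
    have "functionally_bounded T (m_inv G ` range (\<lambda>n. inv (s n)))"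
      by (rule functionally_bounded_image[OF bdd continuous_inv]) (use sE in auto)
    then show ?thesis using sG by (simp add: image_image)
  qed
  have "raikov_cauchy_filter G T M"
    unfolding raikov_cauchy_filter_def
  proof (intro conjI allI impI)
    show "M \<le> principal (carrier G)"
      using M(3) EG by (auto simp: le_principal elim: eventually_mono)
    fix U assume "openin T U \<and> \<one> \<in> U"
    then have U: "openin T U" "\<one> \<in> U" by auto
    obtain V where V: "openin T V" "\<one> \<in> V" "\<And>x. x \<in> V \<Longrightarrow> inv x \<in> V"
        "\<And>x y. \<lbrakk>x \<in> V; y \<in> V\<rbrakk> \<Longrightarrow> x \<otimes> y \<in> U"
      using one_nbhd_sqrt[OF U] by metis
    have "\<exists>F. finite F \<and> F \<subseteq> E \<and> (\<forall>y\<in>E. \<exists>x\<in>F. inv x \<otimes> y \<in> V)"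
      by (rule ex_finite_left_cover[OF EG V(1,2)]) (rule bdd)
    then obtain F where F: "finite F" "F \<subseteq> E" "\<forall>y\<in>E. \<exists>x\<in>F. inv x \<otimes> y \<in> V"
      by blast
    have "m_inv G ` E \<subseteq> carrier G" using EG by auto
    then have "\<exists>H. finite H \<and> H \<subseteq> m_inv G ` E \<and> (\<forall>y\<in>m_inv G ` E. \<exists>x\<in>H. inv x \<otimes> y \<in> V)"
      by (rule ex_finite_left_cover[OF _ V(1,2)]) (rule bdd_inv)
    then obtain H where H: "finite H" "H \<subseteq> m_inv G ` E" "\<forall>y\<in>m_inv G ` E. \<exists>x\<in>H. inv x \<otimes> y \<in> V"
      by blast
    have "eventually (\<lambda>y. \<exists>x\<in>F. inv x \<otimes> y \<in> V) M"
      using M(3) F(3) by (auto elim: eventually_mono)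
    from ultrafilter_finite_cover[OF M(1,2) F(1) this]
    obtain a where a: "a \<in> F" "eventually (\<lambda>y. inv a \<otimes> y \<in> V) M" by blast
    have "eventually (\<lambda>y. \<exists>x\<in>H. inv x \<otimes> inv y \<in> V) M"
      using M(3) H(3) by (auto elim: eventually_mono)
    from ultrafilter_finite_cover[OF M(1,2) H(1) this]
    obtain b where b: "b \<in> H" "eventually (\<lambda>y. inv b \<otimes> inv y \<in> V) M" by blast
    have ab: "a \<in> carrier G" "b \<in> carrier G"
      using a(1) b(1) F(2) H(2) \<open>m_inv G ` E \<subseteq> carrier G\<close> EG by blast+
    \<comment> \<open>\<open>A\<close> is small on both sides: \<open>a\<close> cancels in the
      quotient \<open>inv x \<otimes> y\<close>, and \<open>b\<close> in
      \<open>x \<otimes> inv y\<close>.\<close>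
    define A where "A = {y \<in> E. inv a \<otimes> y \<in> V \<and> inv b \<otimes> inv y \<in> V}"
    have "eventually (\<lambda>y. y \<in> A) M"
      using M(3) a(2) b(2) by eventually_elim (simp add: A_def)
    moreover have "inv x \<otimes> y \<in> U \<and> x \<otimes> inv y \<in> U" if x: "x \<in> A" and y: "y \<in> A" for x y
    proof -
      have xy: "x \<in> carrier G" "y \<in> carrier G" using x y EG by (auto simp: A_def)
      have "inv (inv a \<otimes> x) \<otimes> (inv a \<otimes> y) \<in> U" "inv (inv b \<otimes> inv x) \<otimes> (inv b \<otimes> inv y) \<in> U"
        using x y by (auto simp: A_def intro: V)
      then show ?thesis using xy ab by (simp add: inv_mult_group m_assoc mult_inv_cancel)
    qed
    ultimately show "\<exists>A\<subseteq>carrier G. eventually (\<lambda>x. x \<in> A) M \<and>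
        (\<forall>x\<in>A. \<forall>y\<in>A. inv x \<otimes> y \<in> U \<and> x \<otimes> inv y \<in> U)"
      using EG by (intro exI[of _ A]) (auto simp: A_def)
  qed (use M in auto)
  then show "\<exists>l. limitin T (\<lambda>x. x) l M" using complete by (simp add: raikov_complete_def)
qed

end

section \<open>Comparison of two topologies\<close>

lemma continuous_map_coarser:
  assumes "continuous_map S S' (\<lambda>x. x)" "continuous_map S' Z f"
  shows "continuous_map S Z f"
  using continuous_map_compose[OF assms] by (simp add: o_def)

lemma limitin_coarser:
  assumes "continuous_map S S' (\<lambda>x. x)" "limitin S s l F"
  shows "limitin S' s l F"
  using continuous_map_limit[OF assms] by (simp add: o_def)

text \<open>A continuous bijection from a compact space onto a Hausdorff space is a homeomorphism;
  applied to the identity, this says that the topologies coincide.\<close>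

lemma subtopology_eq_on_compactin:
  assumes id: "continuous_map S S' (\<lambda>x. x)" and S': "Hausdorff_space S'" and K: "compactin S K"
  shows "subtopology S K = subtopology S' K"
proof -
  have hom: "homeomorphic_map (subtopology S K) (subtopology S' K) (\<lambda>x. x)"
  proof (rule continuous_imp_homeomorphic_map)
    show "compact_space (subtopology S K)" using K by (simp add: compact_space_subtopology)
    show "Hausdorff_space (subtopology S' K)" using S' by (simp add: Hausdorff_space_subtopology)
    have *: "K \<subseteq> topspace S" using K by (rule compactin_subset_topspace)
    moreover have "K \<subseteq> topspace S'"
      using * continuous_map_image_subset_topspace[OF id] by auto
    ultimately show "(\<lambda>x. x) ` topspace (subtopology S K) = topspace (subtopology S' K)" by auto
    show "continuous_map (subtopology S K) (subtopology S' K) (\<lambda>x. x)"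
      using id by (auto simp: continuous_map_in_subtopology continuous_map_from_subtopology)
  qed (simp add: inj_on_def)
  have "openin (subtopology S K) U \<longleftrightarrow> openin (subtopology S' K) U" for U
  proof -
    have "topspace (subtopology S K) = topspace (subtopology S' K)"
      using homeomorphic_imp_surjective_map[OF hom] by simp
    then show ?thesis
      using homeomorphic_map_openness_eq[OF hom, of U] openin_subset[of "subtopology S' K" U]
      by (simp only: image_ident) blast
  qed
  then show ?thesis unfolding topology_eq by blast
qed

text \<open>Collects what the group theory supplies, with \<open>S\<close> the original topology and
  \<open>S'\<close> that of \<open>X\<^sup>+\<close>; the comparison of compact-like sets is then
  purely topological.\<close>

locale compact_like_comparison =
  fixes S S' :: "'a topology"
  assumes topspace_eq: "topspace S = topspace S'"
    and coarser: "continuous_map S S' (\<lambda>x. x)"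
    and Hausdorff': "Hausdorff_space S'"
    and compact_envelope: "functionally_bounded S' E \<Longrightarrow> \<exists>K. compactin S K \<and> E \<subseteq> K"
begin

lemma subtopology_eq:
  assumes "functionally_bounded S' E"
  shows "subtopology S E = subtopology S' E"
proof -
  obtain K where K: "compactin S K" "E \<subseteq> K" using compact_envelope[OF assms] by blast
  have "subtopology (subtopology S K) E = subtopology (subtopology S' K) E"
    using subtopology_eq_on_compactin[OF coarser Hausdorff' K(1)] by simp
  then show ?thesis using K(2) by (simp add: subtopology_subtopology Int_absorb1)
qed

lemma limitin_iff:
  assumes "functionally_bounded S' E" "range s \<subseteq> E" "l \<in> E"
  shows "limitin S s l F \<longleftrightarrow> limitin S' s l F"
proof -
  have "limitin (subtopology S E) s l F \<longleftrightarrow> limitin (subtopology S' E) s l F"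
    by (simp add: subtopology_eq[OF assms(1)])
  moreover have "eventually (\<lambda>x. s x \<in> E) F" using assms(2) by (intro always_eventually) blast
  ultimately show ?thesis using assms(3) by (simp add: limitin_subtopology)
qed

lemma functionally_bounded_sets_eq: "functionally_bounded_sets S = functionally_bounded_sets S'"
proof -
  have "functionally_bounded S E \<longleftrightarrow> functionally_bounded S' E" for E
  proof
    assume "functionally_bounded S' E"
    then show "functionally_bounded S E"
      using compact_envelope compactin_imp_functionally_bounded functionally_bounded_subset by blast
  qed (use functionally_bounded_image[OF _ coarser, of E] in simp)
  then show ?thesis by (simp add: functionally_bounded_sets_def)
qed

lemma compact_sets_eq: "compact_sets S = compact_sets S'"
proof -
  have "compactin S E \<longleftrightarrow> compactin S' E" for E
  proof
    assume E: "compactin S' E"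
    then have "compactin (subtopology S' E) E" by simp
    then show "compactin S E"
      using subtopology_eq[OF compactin_imp_functionally_bounded[OF E]] by (metis compactin_absolute)
  qed (use image_compactin[OF _ coarser, of E] in simp)
  then show ?thesis by (simp add: compact_sets_def)
qed

text \<open>A convergent sequence with its limit is compact, hence functionally bounded, so its
  convergence can be tested in a subspace on which \<open>S\<close> and \<open>S'\<close>
  agree.\<close>

lemma convergent_sequence_sets_eq: "convergent_sequence_sets S = convergent_sequence_sets S'"
proof (intro subset_antisym subsetI)
  fix E assume "E \<in> convergent_sequence_sets S"
  then show "E \<in> convergent_sequence_sets S'"
    using topspace_eq limitin_coarser[OF coarser] by (fastforce simp: convergent_sequence_sets_def)
next
  fix E assume E: "E \<in> convergent_sequence_sets S'"
  then have fb: "functionally_bounded S' E"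
    by (intro compactin_imp_functionally_bounded convergent_sequence_imp_compactin)
  obtain s l where sl: "E = range s \<union> {l}" "range s \<subseteq> topspace S'" "limitin S' s l sequentially"
    using E by (auto simp: convergent_sequence_sets_def)
  have "limitin S s l sequentially" using limitin_iff[OF fb] sl by auto
  then show "E \<in> convergent_sequence_sets S"
    using sl topspace_eq by (auto simp: convergent_sequence_sets_def)
qed

lemma sequentially_compact_sets_eq: "sequentially_compact_sets S = sequentially_compact_sets S'"
proof (intro subset_antisym subsetI)
  fix E assume "E \<in> sequentially_compact_sets S"
  then show "E \<in> sequentially_compact_sets S'"
    using topspace_eq limitin_coarser[OF coarser] unfolding sequentially_compact_sets_def by blast
next
  fix E assume E: "E \<in> sequentially_compact_sets S'"
  have "limitin S (s \<circ> r) l sequentially \<longleftrightarrow> limitin S' (s \<circ> r) l sequentially"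
    if "range s \<subseteq> E" "l \<in> E" for s and r :: "nat \<Rightarrow> nat" and l
    using that by (intro limitin_iff[OF sequentially_compact_imp_functionally_bounded[OF E]]) auto
  then show "E \<in> sequentially_compact_sets S"
    using E topspace_eq by (simp add: sequentially_compact_sets_def)
qed

text \<open>Passing to the coarser topology only adds accumulation points. Conversely, the
  accumulation points inside \<open>E\<close> of subsets of \<open>E\<close> are determined by the
  subspace topology.\<close>

lemma countably_compact_sets_eq: "countably_compact_sets S = countably_compact_sets S'"
proof (intro subset_antisym subsetI)
  fix E assume E: "E \<in> countably_compact_sets S"
  have "S derived_set_of B \<subseteq> S' derived_set_of B" for B
  proof
    fix x assume x: "x \<in> S derived_set_of B"
    have "openin S U" if "openin S' U" for U
      using openin_continuous_map_preimage[OF coarser that] openin_subset[OF that] topspace_eq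
      by (simp add: Collect_conj_eq Int_absorb1)
    then show "x \<in> S' derived_set_of B" using x topspace_eq by (auto simp: in_derived_set_of)
  qed
  then show "E \<in> countably_compact_sets S'"
    using E topspace_eq unfolding countably_compact_sets_def by blast
next
  fix E assume E: "E \<in> countably_compact_sets S'"
  have "E \<inter> S derived_set_of B = E \<inter> S' derived_set_of B" if "B \<subseteq> E" for B
    using subtopology_eq[OF countably_compact_imp_functionally_bounded[OF E Hausdorff']] that
    by (metis derived_set_of_subtopology Int_absorb1)
  then show "E \<in> countably_compact_sets S"
    using E topspace_eq by (simp add: countably_compact_sets_def)
qed

lemma pseudocompact_sets_eq: "pseudocompact_sets S = pseudocompact_sets S'"
proof (intro subset_antisym subsetI)
  fix E assume E: "E \<in> pseudocompact_sets S"
  have "continuous_map (subtopology S E) (subtopology S' E) (\<lambda>x. x)"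
    using coarser by (auto simp: continuous_map_in_subtopology continuous_map_from_subtopology)
  then show "E \<in> pseudocompact_sets S'"
    using E topspace_eq continuous_map_coarser unfolding pseudocompact_sets_def by blast
next
  fix E assume E: "E \<in> pseudocompact_sets S'"
  then show "E \<in> pseudocompact_sets S"
    using subtopology_eq[OF pseudocompact_imp_functionally_bounded[OF E]] topspace_eq
    by (simp add: pseudocompact_sets_def)
qed

end

section \<open>The topology of \<open>X\<^sup>+\<close> and the conclusion\<close>

context bohr
begin

lemma topspace_bohr_modification: "topspace (bohr_modification X T) = topspace T"
  using bohr_map_in topological_group.topspace_eq_carrier[OF topological_group_bohr]
  by (auto simp: bohr_modification_def topspace_pullback_topology topspace_eq_carrier carrier_bohr_group)

lemma continuous_map_bohr_modification: "continuous_map T (bohr_modification X T) (\<lambda>x. x)"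
  unfolding bohr_modification_def
  by (rule continuous_map_pullback') (use continuous_bohr_map in \<open>auto simp: o_def topspace_eq_carrier\<close>)

end

theorem proposition4p6:
  fixes X :: "('a, 'm) monoid_scheme" and T :: "'a topology"
  assumes "topological_group X T"
    and "raikov_complete X T"
    and "MAP_group X T"
    and "SB_property X T"
  shows "(respects_property X T convergent_sequence_sets \<and>
          respects_property X T compact_sets \<and>
          respects_property X T sequentially_compact_sets \<and>
          respects_property X T countably_compact_sets \<and>
          respects_property X T pseudocompact_sets \<and>
          respects_property X T functionally_bounded_sets)
         \<and> mu_space (bohr_modification X T)"
proof -
  interpret topological_group X T by fact
  interpret bohr X T by unfold_locales
  let ?P = "bohr_modification X T"
  \<comment> \<open>The closure is taken in \<open>?P\<close> but is compact in the finer
    \<open>T\<close>. It is closed in \<open>T\<close>, and it stays functionally bounded in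
    \<open>?P\<close>, so the \<open>SB\<close>-property makes each of its sequences functionally
    bounded in \<open>T\<close>.\<close>
  have compact_closure: "compactin T (?P closure_of E)" if "functionally_bounded ?P E" for E
  proof (rule raikov_complete_compactin[OF assms(2)])
    have "{x \<in> topspace T. x \<in> ?P closure_of E} = ?P closure_of E"
      using closure_of_subset_topspace[of ?P E] topspace_bohr_modification by auto
    then show "closedin T (?P closure_of E)"
      using closedin_continuous_map_preimage[OF continuous_map_bohr_modification, of "?P closure_of E"]
      by simp
    show "functionally_bounded T (range s)" if "range s \<subseteq> ?P closure_of E" for s :: "nat \<Rightarrow> 'a"
      using functionally_bounded_subset[OF functionally_bounded_closure_of that]
        \<open>functionally_bounded ?P E\<close> assms(4) by (simp add: SB_property_def)
  qed
  \<comment> \<open>The compact envelope of \<open>E\<close> is its closure in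
    \<open>?P\<close>.\<close>
  interpret compact_like_comparison T ?P
  proof
    show "Hausdorff_space ?P" using assms(3) by (simp add: MAP_group_def)
    show "\<exists>K. compactin T K \<and> E \<subseteq> K" if "functionally_bounded ?P E" for E
      using compact_closure[OF that] that closure_of_subset[of E ?P]
      by (auto simp: functionally_bounded_def)
  qed (simp_all add: topspace_bohr_modification continuous_map_bohr_modification)
  have "mu_space ?P"
    using compact_closure compact_sets_eq by (auto simp: mu_space_def compact_sets_def)
  then show ?thesis
    by (simp add: respects_property_def convergent_sequence_sets_eq compact_sets_eq
        sequentially_compact_sets_eq countably_compact_sets_eq pseudocompact_sets_eq
        functionally_bounded_sets_eq)
qed

end
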